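(* Let $T$ be a $3$-simplex with barycentric coordinates $\lambda_0,\lambda_1,\lambda_2,\lambda_3$. An $\mathbb{R}$-invariant basis of the space $\mathbb{R}\mathcal{P}_0\Lambda^{1}(T)$ of constant real differential $1$-forms over $T$ is given by $$\psi_{w}=d\lambda_0-d\lambda_1+d\lambda_2-d\lambda_3,\quad \psi_{p}=d\lambda_0+d\lambda_1-d\lambda_2-d\lambda_3,\quad \psi_{k}=d\lambda_0-d\lambda_1-d\lambda_2+d\lambda_3.$$ In particular, this is also a $\mathbb{C}$-invariant basis of the space $\mathbb{C}\mathcal{P}_{0}\Lambda^{1}(T)$ of constant complex $1$-forms over $T$.
   Context: $T$ is the convex hull of affinely independent points $v_0,\dots,v_n$ in a Euclidean space (here $n=3$); $\lambda_i$ are its barycentric coordinates (affine functions on $T$ with $\lambda_i(v_j)=\delta_{ij}$), $d\lambda_i$ their exterior derivatives. For $\mathbb{F}\in\{\mathbb{R},\mathbb{C}\}$, $\mathbb{F}\mathcal{P}_0\Lambda^k(T)$ is the $\mathbb{F}$-span of the forms $d\lambda_{i_1}\wedge\dots\wedge d\lambda_{i_k}$, i.e. the constant $k$-forms on $T$ with coefficients in $\mathbb{F}$. $\mathrm{Perm}(n)$ is the group of permutations of $\{0,\dots,n\}$; for $\pi\in\mathrm{Perm}(n)$, $S_\pi:T\to T$ is the affine automorphism with $S_\pi(v_i)=v_{\pi^{-1}(i)}$, with pullback $S_\pi^*$ on forms. A finite set $\{\omega_1,\dots,\omega_M\}$ of pairwise distinct forms on $T$ is $\mathbb{F}$-invariant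 if for every $\pi\in\mathrm{Perm}(n)$ there are a permutation $\tau$ of $\{1,\dots,M\}$ and $\chi_1,\dots,\chi_M\in\mathbb{F}$ with $|\chi_i|=1$ and $S_\pi^*\omega_i=\chi_i\omega_{\tau(i)}$ for all $i$. *)

theory Defs
  imports "HOL-Analysis.Analysis" "HOL-Library.Function_Algebras" "HOL-Combinatorics.Permutations"
begin

definition affine_fun_on :: "'a::real_vector set \<Rightarrow> ('a \<Rightarrow> 'b::real_vector) \<Rightarrow> bool" where
  "affine_fun_on T f \<longleftrightarrow>
     (\<forall>x\<in>T. \<forall>y\<in>T. \<forall>t\<in>{0..1}. f ((1 - t) *\<^sub>R x + t *\<^sub>R y) = (1 - t) *\<^sub>R f x + t *\<^sub>R f y)"

definition simplex_vertices :: "(nat \<Rightarrow> 'a::real_vector) \<Rightarrow> nat \<Rightarrow> bool" where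
  "simplex_vertices v n \<longleftrightarrow> inj_on v {0..n} \<and> \<not> affine_dependent (v ` {0..n})"

definition simplex_hull :: "(nat \<Rightarrow> 'a::real_vector) \<Rightarrow> nat \<Rightarrow> 'a set" where
  "simplex_hull v n = convex hull (v ` {0..n})"

text \<open>The affine function on the simplex with prescribed vertex values. It is made unique as a
  HOL function by extensionality (value \<^term>\<open>undefined\<close> off the simplex); see
  \<open>ex1_affine_interp\<close> below.\<close>

definition affine_interp ::
    "(nat \<Rightarrow> 'a::real_vector) \<Rightarrow> nat \<Rightarrow> (nat \<Rightarrow> 'b::real_vector) \<Rightarrow> 'a \<Rightarrow> 'b" where
  "affine_interp v n w = (THE f. f \<in> extensional (simplex_hull v n) \<and>
     affine_fun_on (simplex_hull v n) f \<and> (\<forall>i\<in>{0..n}. f (v i) = w i))"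

definition bary :: "(nat \<Rightarrow> 'a::real_vector) \<Rightarrow> nat \<Rightarrow> nat \<Rightarrow> 'a \<Rightarrow> real" where
  "bary v n i = affine_interp v n (\<lambda>j. of_bool (i = j))"

definition simplex_map :: "(nat \<Rightarrow> 'a::real_vector) \<Rightarrow> nat \<Rightarrow> (nat \<Rightarrow> nat) \<Rightarrow> 'a \<Rightarrow> 'a" where
  "simplex_map v n \<pi> = affine_interp v n (\<lambda>i. v (inv \<pi> i))"

lemma affine_fun_on_convex_sum:
  fixes f :: "'a::real_vector \<Rightarrow> 'b::real_vector"
  assumes "finite I" "affine_fun_on T f" "convex T" "\<And>i. i \<in> I \<Longrightarrow> x i \<in> T"
    and "\<And>i. i \<in> I \<Longrightarrow> 0 \<le> c i" "sum c I = 1"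
  shows "f (\<Sum>i\<in>I. c i *\<^sub>R x i) = (\<Sum>i\<in>I. c i *\<^sub>R f (x i))"
proof -
  define G where "G = (\<lambda>x. (x, f x)) ` T"
  have "convex G"
    unfolding convex_alt
  proof (intro ballI allI impI)
    fix p q and u :: real
    assume "p \<in> G" "q \<in> G" and u: "0 \<le> u \<and> u \<le> 1"
    then obtain a b where ab: "a \<in> T" "b \<in> T" "p = (a, f a)" "q = (b, f b)"
      by (auto simp: G_def)
    have "(1 - u) *\<^sub>R a + u *\<^sub>R b \<in> T"
      using assms(3) ab u by (auto simp: convex_alt)
    moreover have "f ((1 - u) *\<^sub>R a + u *\<^sub>R b) = (1 - u) *\<^sub>R f a + u *\<^sub>R f b"
      using assms(2) ab u by (auto simp: affine_fun_on_def)
    ultimately show "(1 - u) *\<^sub>R p + u *\<^sub>R q \<in> G"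
      using ab by (auto simp: G_def image_iff)
  qed
  then have "(\<Sum>i\<in>I. c i *\<^sub>R (x i, f (x i))) \<in> G"
    using assms by (intro convex_sum) (auto simp: G_def)
  then show ?thesis
    by (auto simp: G_def fst_sum snd_sum scaleR_prod_def prod_eq_iff)
qed

lemma simplex_hull_eq:
  assumes "inj_on v {0..n}"
  shows "simplex_hull v n =
    {\<Sum>i\<in>{0..n}. c i *\<^sub>R v i |c. (\<forall>i\<in>{0..n}. 0 \<le> c i) \<and> sum c {0..n} = 1}" (is "_ = ?R")
proof
  show "simplex_hull v n \<subseteq> ?R"
  proof
    fix x assume "x \<in> simplex_hull v n"
    then obtain u where u: "\<forall>y\<in>v ` {0..n}. 0 \<le> u y" "sum u (v ` {0..n}) = 1"
      "(\<Sum>y\<in>v ` {0..n}. u y *\<^sub>R y) = x"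
      by (auto simp: simplex_hull_def convex_hull_finite)
    then show "x \<in> ?R"
      using assms by (auto simp: sum.reindex intro!: exI[of _ "u \<circ> v"])
  qed
  show "?R \<subseteq> simplex_hull v n"
    unfolding simplex_hull_def
    by (auto intro!: convex_sum convex_convex_hull intro: hull_inc)
qed

lemma simplex_hull_coords_unique:
  assumes "simplex_vertices v n" "sum c {0..n} = sum d {0..n}"
    and "(\<Sum>i\<in>{0..n}. c i *\<^sub>R v i) = (\<Sum>i\<in>{0..n}. d i *\<^sub>R v i)" "i \<in> {0..n}"
  shows "c i = d i"
proof (rule ccontr)
  assume ne: "c i \<noteq> d i"
  have inj: "inj_on v {0..n}" and ind: "\<not> affine_dependent (v ` {0..n})"
    using assms(1) by (auto simp: simplex_vertices_def)
  define g where "g = the_inv_into {0..n} v"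
  have g: "g (v j) = j" if "j \<in> {0..n}" for j
    using that inj by (simp add: g_def the_inv_into_f_f)
  let ?U = "\<lambda>y. c (g y) - d (g y)"
  have "sum ?U (v ` {0..n}) = 0"
    using inj g assms(2) by (simp add: sum.reindex sum_subtractf)
  moreover have "(\<Sum>y\<in>v ` {0..n}. ?U y *\<^sub>R y) = 0"
    using inj g assms(3) by (simp add: sum.reindex sum_subtractf scaleR_left_diff_distrib)
  moreover have "\<exists>y\<in>v ` {0..n}. ?U y \<noteq> 0"
    using ne assms(4) g by (intro bexI[of _ "v i"]) auto
  ultimately have "affine_dependent (v ` {0..n})"
    by (subst affine_dependent_explicit_finite, simp) (rule exI[of _ ?U], blast)
  with ind show False by simp
qed

lemma ex1_affine_interp:
  fixes v :: "nat \<Rightarrow> 'a::real_vector" and w :: "nat \<Rightarrow> 'b::real_vector"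
  assumes v: "simplex_vertices v n"
  shows "\<exists>!f. f \<in> extensional (simplex_hull v n) \<and>
     affine_fun_on (simplex_hull v n) f \<and> (\<forall>i\<in>{0..n}. f (v i) = w i)"
proof (rule ex_ex1I)
  let ?T = "simplex_hull v n"
  have inj: "inj_on v {0..n}" using v by (simp add: simplex_vertices_def)
  have vT: "v i \<in> ?T" if "i \<in> {0..n}" for i
    using that by (auto simp: simplex_hull_def intro!: hull_inc)
  have cvx: "convex ?T" by (simp add: simplex_hull_def)
  define P where "P x c \<longleftrightarrow> (\<forall>i\<in>{0..n}. 0 \<le> c i) \<and> sum c {0..n} = (1::real) \<and>
      (\<Sum>i\<in>{0..n}. c i *\<^sub>R v i) = x" for x c
  define C where "C x = (SOME c. P x c)" for x
  have "P x (C x)" if "x \<in> ?T" for x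
  proof -
    have "\<exists>c. P x c"
      using that unfolding simplex_hull_eq[OF inj] P_def mem_Collect_eq by metis
    then show ?thesis unfolding C_def by (rule someI_ex)
  qed
  then have C: "\<And>i. i \<in> {0..n} \<Longrightarrow> 0 \<le> C x i" "sum (C x) {0..n} = 1"
    "(\<Sum>i\<in>{0..n}. C x i *\<^sub>R v i) = x" if "x \<in> ?T" for x
    using that unfolding P_def by blast+
  have Ceq: "C x i = c i"
    if "x \<in> ?T" "(\<Sum>i\<in>{0..n}. c i *\<^sub>R v i) = x" "sum c {0..n} = 1" "i \<in> {0..n}" for x c i
  proof (rule simplex_hull_coords_unique[OF v _ _ that(4)])
    show "sum (C x) {0..n} = sum c {0..n}" using C(2)[OF that(1)] that(3) by simp
    show "(\<Sum>i\<in>{0..n}. C x i *\<^sub>R v i) = (\<Sum>i\<in>{0..n}. c i *\<^sub>R v i)"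
      using C(3)[OF that(1)] that(2) by simp
  qed
  define f where "f = restrict (\<lambda>x. \<Sum>i\<in>{0..n}. C x i *\<^sub>R w i) ?T"
  have "affine_fun_on ?T f"
    unfolding affine_fun_on_def
  proof (intro ballI)
    fix x y and t :: real assume xy: "x \<in> ?T" "y \<in> ?T" and t: "t \<in> {0..1}"
    let ?z = "(1 - t) *\<^sub>R x + t *\<^sub>R y"
    have z: "?z \<in> ?T" using cvx xy t by (auto simp: convex_alt)
    have "C ?z i = (1 - t) * C x i + t * C y i" if "i \<in> {0..n}" for i
    proof (rule Ceq[OF z _ _ that])
      have "(\<Sum>i\<in>{0..n}. ((1 - t) * C x i + t * C y i) *\<^sub>R v i) =
          (1 - t) *\<^sub>R (\<Sum>i\<in>{0..n}. C x i *\<^sub>R v i) + t *\<^sub>R (\<Sum>i\<in>{0..n}. C y i *\<^sub>R v i)"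
        by (simp add: scaleR_add_left sum.distrib scaleR_sum_right)
      then show "(\<Sum>i\<in>{0..n}. ((1 - t) * C x i + t * C y i) *\<^sub>R v i) = ?z"
        by (simp only: C(3)[OF xy(1)] C(3)[OF xy(2)])
      show "(\<Sum>i\<in>{0..n}. (1 - t) * C x i + t * C y i) = 1"
        using C(2)[OF xy(1)] C(2)[OF xy(2)] by (simp add: sum.distrib flip: sum_distrib_left)
    qed
    then show "f ?z = (1 - t) *\<^sub>R f x + t *\<^sub>R f y"
      using xy z
      by (simp add: f_def scaleR_add_left sum.distrib scaleR_sum_right)
  qed
  moreover have "f (v i) = w i" if i: "i \<in> {0..n}" for i
  proof -
    have "C (v i) j = of_bool (j = i)" if "j \<in> {0..n}" for j
      using i by (intro Ceq[OF vT[OF i] _ _ that]) (auto simp: of_bool_def if_distrib[of "\<lambda>c. c *\<^sub>R _"] cong: if_cong)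
    then show ?thesis
      using i vT by (simp add: f_def of_bool_def if_distrib[of "\<lambda>c. c *\<^sub>R _"] cong: if_cong)
  qed
  ultimately show "\<exists>f. f \<in> extensional ?T \<and> affine_fun_on ?T f \<and> (\<forall>i\<in>{0..n}. f (v i) = w i)"
    by (intro exI[of _ f]) (auto simp: f_def)
  fix f g :: "'a \<Rightarrow> 'b"
  assume f: "f \<in> extensional ?T \<and> affine_fun_on ?T f \<and> (\<forall>i\<in>{0..n}. f (v i) = w i)"
    and g: "g \<in> extensional ?T \<and> affine_fun_on ?T g \<and> (\<forall>i\<in>{0..n}. g (v i) = w i)"
  show "f = g"
  proof (rule extensionalityI[of _ ?T])
    fix x assume x: "x \<in> ?T"
    have *: "h x = (\<Sum>i\<in>{0..n}. C x i *\<^sub>R w i)"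
      if "affine_fun_on ?T h" "\<forall>i\<in>{0..n}. h (v i) = w i" for h :: "'a \<Rightarrow> 'b"
    proof -
      have "h x = h (\<Sum>i\<in>{0..n}. C x i *\<^sub>R v i)" using C(3)[OF x] by simp
      also have "\<dots> = (\<Sum>i\<in>{0..n}. C x i *\<^sub>R h (v i))"
        by (rule affine_fun_on_convex_sum[OF _ that(1) cvx])
          (simp_all only: vT C(1,2)[OF x] finite_atLeastAtMost)
      finally show ?thesis using that by simp
    qed
    show "f x = g x" using *[of f] *[of g] f g by simp
  qed (use f g in auto)
qed

definition tangent :: "'a::real_vector set \<Rightarrow> 'a set" where
  "tangent T = span {x - y |x y. x \<in> T \<and> y \<in> T}"

text \<open>A 1-form on \<open>T\<close> maps a point \<open>x\<close> and a tangent vector \<open>u\<close> to a scalar. Forms are set to 0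
  off \<open>T \<times> tangent T\<close>, so that equality of forms on \<open>T\<close> is equality of functions and the vector
  space operations are pointwise.\<close>

type_synonym ('a, 'f) form = "'a \<Rightarrow> 'a \<Rightarrow> 'f"

definition one_forms :: "'a::real_vector set \<Rightarrow> ('a, 'f::real_vector) form set" where
  "one_forms T = {\<omega>.
     (\<forall>x\<in>T. \<forall>u\<in>tangent T. \<forall>w\<in>tangent T. \<forall>a b. \<omega> x (a *\<^sub>R u + b *\<^sub>R w) = a *\<^sub>R \<omega> x u + b *\<^sub>R \<omega> x w) \<and>
     (\<forall>x u. x \<notin> T \<or> u \<notin> tangent T \<longrightarrow> \<omega> x u = 0)}"

definition form_scale :: "'f \<Rightarrow> ('a, 'f) form \<Rightarrow> ('a, 'f::field) form" where
  "form_scale c \<omega> = (\<lambda>x u. c * \<omega> x u)"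

interpretation form_space: vector_space "form_scale :: 'f::field \<Rightarrow> ('a, 'f) form \<Rightarrow> ('a, 'f) form"
  by unfold_locales (auto simp: form_scale_def fun_eq_iff algebra_simps)

text \<open>For a simplex \<open>T\<close> (convex, with \<^term>\<open>tangent T\<close> spanned by the directions into \<open>T\<close> at each
  of its points) a derivative within \<open>T\<close> is unique on \<^term>\<open>tangent T\<close>, so the choice made by
  \<^const>\<open>frechet_derivative\<close> does not matter here.\<close>

definition ext_deriv ::
    "'a::real_normed_vector set \<Rightarrow> ('a \<Rightarrow> 'f::real_normed_vector) \<Rightarrow> ('a, 'f) form" where
  "ext_deriv T f = (\<lambda>x u. if x \<in> T \<and> u \<in> tangent T
     then frechet_derivative f (at x within T) u else 0)"

definition pullback ::
    "'a::real_normed_vector set \<Rightarrow> ('a \<Rightarrow> 'a) \<Rightarrow> ('a, 'f::zero) form \<Rightarrow> ('a, 'f) form" where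
  "pullback T S \<omega> = (\<lambda>x u. if x \<in> T \<and> u \<in> tangent T
     then \<omega> (S x) (frechet_derivative S (at x within T) u) else 0)"

definition dbary ::
    "(nat \<Rightarrow> 'a::real_normed_vector) \<Rightarrow> nat \<Rightarrow> nat \<Rightarrow> ('a, 'f::real_normed_field) form" where
  "dbary v n i = ext_deriv (simplex_hull v n) (\<lambda>x. of_real (bary v n i x))"

definition const_one_forms ::
    "(nat \<Rightarrow> 'a::real_normed_vector) \<Rightarrow> nat \<Rightarrow> ('a, 'f::real_normed_field) form set" where
  "const_one_forms v n = form_space.span (dbary v n ` {0..n})"

definition invariant_forms ::
    "(nat \<Rightarrow> 'a::real_normed_vector) \<Rightarrow> nat \<Rightarrow> ('a, 'f::real_normed_field) form list \<Rightarrow> bool" where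
  "invariant_forms v n \<omega>s \<longleftrightarrow>
     distinct \<omega>s \<and> set \<omega>s \<subseteq> one_forms (simplex_hull v n) \<and>
     (\<forall>\<pi>. \<pi> permutes {0..n} \<longrightarrow>
       (\<exists>\<tau> c. \<tau> permutes {..<length \<omega>s} \<and>
         (\<forall>i<length \<omega>s. norm (c i) = 1 \<and>
           pullback (simplex_hull v n) (simplex_map v n \<pi>) (\<omega>s ! i) =
             form_scale (c i) (\<omega>s ! \<tau> i))))"

definition is_basis :: "('a, 'f::field) form list \<Rightarrow> ('a, 'f) form set \<Rightarrow> bool" where
  "is_basis \<omega>s V \<longleftrightarrow>
     distinct \<omega>s \<and> form_space.independent (set \<omega>s) \<and> form_space.span (set \<omega>s) = V"

definition psi_w :: "(nat \<Rightarrow> 'a::real_normed_vector) \<Rightarrow> ('a, 'f::real_normed_field) form" where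
  "psi_w v = dbary v 3 0 - dbary v 3 1 + dbary v 3 2 - dbary v 3 3"

definition psi_p :: "(nat \<Rightarrow> 'a::real_normed_vector) \<Rightarrow> ('a, 'f::real_normed_field) form" where
  "psi_p v = dbary v 3 0 + dbary v 3 1 - dbary v 3 2 - dbary v 3 3"

definition psi_k :: "(nat \<Rightarrow> 'a::real_normed_vector) \<Rightarrow> ('a, 'f::real_normed_field) form" where
  "psi_k v = dbary v 3 0 - dbary v 3 1 - dbary v 3 2 + dbary v 3 3"

end

theory Submission
  imports Defs
begin

text \<open>
  A constant one-form \<open>\<Sum>\<^sub>j a\<^sub>j d\<lambda>\<^sub>j\<close> takes the value \<open>a\<^sub>j - a\<^sub>k\<close> on the edge vector
  \<open>v\<^sub>j - v\<^sub>k\<close>, and \<open>S\<^sub>\<pi>\<close> pulls \<open>d\<lambda>\<^sub>j\<close> back to \<open>d\<lambda>\<^bsub>\<pi> j\<^esub>\<close>, so that it permutes the coefficient vectors.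
  The coefficient vectors of \<open>\<psi>\<^sub>w, \<psi>\<^sub>p, \<psi>\<^sub>k\<close> are, up to sign, all the vectors in \<open>{1, -1}\<^sup>4\<close>
  with sum \<open>0\<close>, and such vectors stay such under permutation of the entries; the three of them are
  pairwise orthogonal, which makes the induced map on indices injective. Together with
  \<open>\<Sum>\<^sub>j d\<lambda>\<^sub>j = 0\<close>, orthogonality also gives \<open>4 d\<lambda>\<^sub>j\<close> as a signed sum of the three forms.
\<close>

subsection \<open>Derivatives of affine functions on a simplex\<close>

text \<open>Subtracting one vertex from the others leaves linearly independent vectors, so some
  linear \<open>L\<close> takes the prescribed increments of \<open>f\<close> there. The points of
  the hull where \<open>L\<close> gives the increment of \<open>f\<close> form a convex set
  containing every vertex, hence fill the hull.\<close>

lemma affine_fun_on_increment_linear: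
  fixes f :: "'a::real_vector \<Rightarrow> 'b::real_vector"
  assumes ind: "\<not> affine_dependent V" and f: "affine_fun_on (convex hull V) f"
  obtains L where "linear L" "\<And>x y. x \<in> convex hull V \<Longrightarrow> y \<in> convex hull V \<Longrightarrow> f y - f x = L (y - x)"
proof (cases "V = {}")
  case True
  then show thesis using that[of "\<lambda>_. 0"] by (simp add: linear_zero)
next
  case False
  then obtain a where a: "a \<in> V" by blast
  let ?T = "convex hull V"
  have "independent ((\<lambda>x. - a + x) ` (V - {a}))"
    using ind affine_dependent_iff_dependent2[OF a] by simp
  from linear_independent_extend[OF this, of "\<lambda>b. f (a + b) - f a"]
  obtain L where L: "linear L"
    "\<forall>x\<in>(\<lambda>x. - a + x) ` (V - {a}). L x = f (a + x) - f a" by blast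
  have LV: "L (y - a) = f y - f a" if "y \<in> V" for y
    using L(2) that by (cases "y = a") (auto simp: linear_0[OF L(1)])
  have "?T \<subseteq> {y \<in> ?T. L (y - a) = f y - f a}"
  proof (rule hull_minimal)
    show "V \<subseteq> {y \<in> ?T. L (y - a) = f y - f a}"
      using LV by (auto intro: hull_inc)
    show "convex {y \<in> ?T. L (y - a) = f y - f a}"
    proof -
      have "L ((1 - t) *\<^sub>R x + t *\<^sub>R y - a) = f ((1 - t) *\<^sub>R x + t *\<^sub>R y) - f a"
        if xy: "x \<in> ?T" "y \<in> ?T" and eq: "L (x - a) = f x - f a" "L (y - a) = f y - f a"
          and t: "0 \<le> t" "t \<le> 1" for x y t
      proof -
        have "L ((1 - t) *\<^sub>R x + t *\<^sub>R y - a) = L ((1 - t) *\<^sub>R (x - a) + t *\<^sub>R (y - a))"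
          by (simp add: algebra_simps)
        then have "L ((1 - t) *\<^sub>R x + t *\<^sub>R y - a) = (1 - t) *\<^sub>R (f x - f a) + t *\<^sub>R (f y - f a)"
          by (simp only: linear_add[OF L(1)] linear_scale[OF L(1)] eq)
        then have "L ((1 - t) *\<^sub>R x + t *\<^sub>R y - a) = (1 - t) *\<^sub>R f x + t *\<^sub>R f y - f a"
          by (simp add: algebra_simps)
        also have "(1 - t) *\<^sub>R f x + t *\<^sub>R f y = f ((1 - t) *\<^sub>R x + t *\<^sub>R y)"
          using f xy t by (auto simp: affine_fun_on_def)
        finally show ?thesis .
      qed
      then show ?thesis
        using convex_convex_hull[of V] by (simp add: convex_alt)
    qed
  qed
  \<comment> \<open>Increments between two arbitrary points reduce to increments from the base
    vertex \<open>a\<close>.\<close>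
  then have *: "L (y - a) = f y - f a" if "y \<in> ?T" for y using that by blast
  have "f y - f x = L (y - x)" if "x \<in> ?T" "y \<in> ?T" for x y
    using *[OF that(1)] *[OF that(2)] linear_diff[OF L(1), of "y - a" "x - a"] by simp
  with L(1) that show thesis by blast
qed

text \<open>A simplex may have empty interior, so derivatives within it are determined only along
  tangent vectors. Restriction to segments starting at \<open>x\<close> reduces the claim to
  one-sided derivatives in one real variable.\<close>

lemma has_derivative_within_convex_unique:
  fixes f :: "'a::real_normed_vector \<Rightarrow> 'b::real_normed_vector"
  assumes "convex T" "x \<in> T" "u \<in> tangent T"
    and D: "(f has_derivative D) (at x within T)"
    and D': "(f has_derivative D') (at x within T)"
  shows "D u = D' u"
proof -
  have seg: "D (y - x) = D' (y - x)" if y: "y \<in> T" for y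
  proof -
    let ?g = "\<lambda>t::real. x + t *\<^sub>R (y - x)"
    have g: "(?g has_derivative (\<lambda>t. t *\<^sub>R (y - x))) (at 0 within {0..1})"
      by (auto intro!: derivative_eq_intros)
    have im: "?g ` {0..1} \<subseteq> T"
    proof clarify
      fix t :: real assume "t \<in> {0..1}"
      then have "(1 - t) *\<^sub>R x + t *\<^sub>R y \<in> T"
        using assms(1,2) y by (simp add: convex_alt)
      then show "?g t \<in> T" by (simp add: algebra_simps)
    qed
    have vd: "((f \<circ> ?g) has_vector_derivative E (y - x)) (at 0 within {0..1})"
      if E: "(f has_derivative E) (at x within T)" for E
    proof -
      have "(f has_derivative E) (at (?g 0) within ?g ` {0..1})"
        using has_derivative_subset[OF E im] by simp
      from diff_chain_within[OF g this] show ?thesis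
        using linear_scale[OF has_derivative_linear[OF E]]
        by (simp add: has_vector_derivative_def o_def)
    qed
    \<comment> \<open>The point 0 is a limit point of the unit interval, so the one-sided derivative
      of \<open>f\<close> along the segment is unique.\<close>
    show ?thesis
      by (rule vector_derivative_unique_within[OF _ vd[OF D] vd[OF D']])
        (simp add: trivial_limit_within islimpt_Icc)
  qed
  have lin: "linear D" "linear D'" using D D' by (auto dest: has_derivative_linear)
  show ?thesis
  proof (rule linear_eq_on_span[OF lin _ assms(3)[unfolded tangent_def]])
    fix w assume "w \<in> {a - b |a b. a \<in> T \<and> b \<in> T}"
    \<comment> \<open>Routing a difference through \<open>x\<close> expresses it by the segment
      directions covered by \<open>seg\<close>.\<close>
    then obtain a b where "a \<in> T" "b \<in> T" "w = (a - x) - (b - x)" by auto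
    then show "D w = D' w"
      using seg by (simp only: linear_diff[OF lin(1)] linear_diff[OF lin(2)])
  qed
qed

text \<open>The linear part of \<open>f\<close> is bounded in finite dimension, hence a derivative
  of \<open>f\<close> within the simplex, and uniqueness identifies it with the chosen one on
  tangent vectors. The same \<open>L\<close> serves at every point, which is why the forms below are
  constant.\<close>

lemma frechet_derivative_affine_fun_on:
  fixes f :: "'a::euclidean_space \<Rightarrow> 'b::real_normed_vector"
  assumes v: "simplex_vertices v n" and f: "affine_fun_on (simplex_hull v n) f"
  obtains L where "linear L"
    "\<And>x y. x \<in> simplex_hull v n \<Longrightarrow> y \<in> simplex_hull v n \<Longrightarrow> L (y - x) = f y - f x"
    "\<And>x u. x \<in> simplex_hull v n \<Longrightarrow> u \<in> tangent (simplex_hull v n) \<Longrightarrow>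
       frechet_derivative f (at x within simplex_hull v n) u = L u"
proof -
  let ?T = "simplex_hull v n"
  obtain L where L: "linear L" "\<And>x y. x \<in> ?T \<Longrightarrow> y \<in> ?T \<Longrightarrow> f y - f x = L (y - x)"
    using affine_fun_on_increment_linear[of "v ` {0..n}" f] v f
    unfolding simplex_vertices_def simplex_hull_def by metis
  have "frechet_derivative f (at x within ?T) u = L u"
    if x: "x \<in> ?T" and u: "u \<in> tangent ?T" for x u
  proof -
    have "((\<lambda>y. f x + L (y - x)) has_derivative L) (at x within ?T)"
    proof -
      have "(L has_derivative L) (at (x - x) within (\<lambda>y. y - x) ` ?T)"
        using L(1) by (simp add: linear_linear bounded_linear_imp_has_derivative)
      moreover have "((\<lambda>y. y - x) has_derivative (\<lambda>h. h)) (at x within ?T)"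
        by (auto intro!: derivative_eq_intros)
      ultimately have "((\<lambda>y. L (y - x)) has_derivative L) (at x within ?T)"
        using diff_chain_within[of "\<lambda>y. y - x" "\<lambda>h. h" x ?T L L] by (simp add: o_def)
      then show ?thesis by (auto intro!: derivative_eq_intros)
    qed
    \<comment> \<open>Only values on the simplex matter for a derivative within it; there
      \<open>f\<close> coincides with its affine expansion at \<open>x\<close>.\<close>
    then have d: "(f has_derivative L) (at x within ?T)"
      by (rule has_derivative_transform[OF x, rotated]) (simp flip: L(2)[OF x])
    then have "(f has_derivative frechet_derivative f (at x within ?T)) (at x within ?T)"
      by (metis differentiable_def frechet_derivative_works)
    from has_derivative_within_convex_unique[OF _ x u this d] show ?thesis
      by (simp add: simplex_hull_def)
  qed
  with L that show thesis by metis
qed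

subsection \<open>One-forms on a simplex\<close>

lemma vertex_in_simplex_hull: "i \<le> n \<Longrightarrow> v i \<in> simplex_hull v n"
  by (auto simp: simplex_hull_def intro!: hull_inc)

lemma diff_in_tangent: "x \<in> T \<Longrightarrow> y \<in> T \<Longrightarrow> x - y \<in> tangent T"
  by (auto simp: tangent_def intro!: span_base)

text \<open>The points whose offset from \<open>v 0\<close> lies in the span of the edges form a
  convex set containing all vertices. This leaves finitely many edge vectors on which forms have to
  be compared.\<close>

lemma tangent_simplex_hull:
  "tangent (simplex_hull v n) = span ((\<lambda>j. v j - v 0) ` {0..n})" (is "_ = span ?B")
proof
  have "simplex_hull v n \<subseteq> {x. x - v 0 \<in> span ?B}"
    unfolding simplex_hull_def
  proof (rule hull_minimal)
    show "v ` {0..n} \<subseteq> {x. x - v 0 \<in> span ?B}" by (auto intro!: span_base)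
    show "convex {x. x - v 0 \<in> span ?B}"
      unfolding convex_alt
    proof (intro ballI allI impI, unfold mem_Collect_eq)
      fix x y and t :: real
      assume "x - v 0 \<in> span ?B" "y - v 0 \<in> span ?B"
      then have "(1 - t) *\<^sub>R (x - v 0) + t *\<^sub>R (y - v 0) \<in> span ?B"
        by (intro span_add span_scale)
      then show "(1 - t) *\<^sub>R x + t *\<^sub>R y - v 0 \<in> span ?B" by (simp add: algebra_simps)
    qed
  qed
  then have *: "x - v 0 \<in> span ?B" if "x \<in> simplex_hull v n" for x using that by blast
  show "tangent (simplex_hull v n) \<subseteq> span ?B"
    unfolding tangent_def
  proof (rule span_minimal, clarify)
    fix x y assume "x \<in> simplex_hull v n" "y \<in> simplex_hull v n"
    then show "x - y \<in> span ?B" using span_diff[OF *[of x] *[of y]] by simp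
  qed simp
  show "span ?B \<subseteq> tangent (simplex_hull v n)"
  proof (rule span_minimal)
    show "?B \<subseteq> tangent (simplex_hull v n)"
      by (auto intro!: diff_in_tangent vertex_in_simplex_hull)
    show "subspace (tangent (simplex_hull v n))" by (simp add: tangent_def)
  qed
qed

lemma one_forms_eqI:
  assumes "\<omega> \<in> one_forms (simplex_hull v n)" "\<eta> \<in> one_forms (simplex_hull v n)"
    and eq: "\<And>x j. x \<in> simplex_hull v n \<Longrightarrow> j \<le> n \<Longrightarrow> \<omega> x (v j - v 0) = \<eta> x (v j - v 0)"
  shows "\<omega> = \<eta>"
proof (intro ext)
  fix x u
  let ?T = "simplex_hull v n"
  show "\<omega> x u = \<eta> x u"
  proof (cases "x \<in> ?T \<and> u \<in> tangent ?T")
    case True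
    then have x: "x \<in> ?T" and u: "u \<in> span ((\<lambda>j. v j - v 0) ` {0..n})"
      by (simp_all add: tangent_simplex_hull)
    have lin: "\<zeta> x (a *\<^sub>R p + b *\<^sub>R q) = a *\<^sub>R \<zeta> x p + b *\<^sub>R \<zeta> x q"
      if "\<zeta> \<in> one_forms ?T" "p \<in> tangent ?T" "q \<in> tangent ?T" for \<zeta> a b p q
      using that x by (simp add: one_forms_def)
    have T0: "0 \<in> tangent ?T" by (simp add: tangent_def span_zero)
    have zero: "\<zeta> x 0 = 0" if "\<zeta> \<in> one_forms ?T" for \<zeta>
      using lin[OF that T0 T0, of 0 0] by simp
    \<comment> \<open>Tangency is carried through the induction because a form is linear only on
      tangent vectors.\<close>
    have "u \<in> tangent ?T \<and> \<omega> x u = \<eta> x u"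
      using u
    proof (induction rule: span_induct_alt)
      case base
      show ?case using T0 assms(1,2) by (simp add: zero)
    next
      case (step c p q)
      then obtain j where j: "j \<le> n" "p = v j - v 0" by auto
      then have p: "p \<in> tangent ?T" by (auto intro!: diff_in_tangent vertex_in_simplex_hull)
      then have "c *\<^sub>R p + q \<in> tangent ?T"
        using step.IH by (auto simp: tangent_def intro: span_add span_scale)
      with step.IH show ?case
        using lin[OF assms(1) p, of q c 1] lin[OF assms(2) p, of q c 1] eq[OF x j(1)] j(2) by simp
    qed
    then show ?thesis by simp
  next
    case False
    then have "\<omega> x u = 0" "\<eta> x u = 0"
      using assms(1,2) unfolding one_forms_def by blast+
    then show ?thesis by simp
  qed
qed

lemma one_forms_add:
  assumes "\<omega> \<in> one_forms T" "\<eta> \<in> one_forms T" shows "\<omega> + \<eta> \<in> one_forms T"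
  using assms unfolding one_forms_def by (simp add: algebra_simps)

lemma one_forms_scale:
  fixes \<omega> :: "('a::real_vector, 'f::real_normed_field) form"
  assumes "\<omega> \<in> one_forms T" shows "form_scale c \<omega> \<in> one_forms T"
  using assms unfolding one_forms_def by (auto simp: form_scale_def algebra_simps)

lemma one_forms_zero: "0 \<in> one_forms T"
  by (simp add: one_forms_def)

lemma one_forms_sum:
  "(\<And>i. i \<in> A \<Longrightarrow> \<omega> i \<in> one_forms T) \<Longrightarrow> sum \<omega> A \<in> one_forms T"
  by (induction A rule: infinite_finite_induct) (auto intro: one_forms_zero one_forms_add)

lemma sum_form_apply:
  fixes \<omega> :: "'i \<Rightarrow> ('a, 'f::comm_monoid_add) form"
  shows "(\<Sum>i\<in>A. \<omega> i) x u = (\<Sum>i\<in>A. \<omega> i x u)"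
  by (induction A rule: infinite_finite_induct) auto

lemma affine_interp:
  assumes "simplex_vertices v n"
  shows "affine_fun_on (simplex_hull v n) (affine_interp v n w)"
    and "i \<le> n \<Longrightarrow> affine_interp v n w (v i) = w i"
  using theI'[OF ex1_affine_interp[OF assms, of w]] by (auto simp: affine_interp_def)

text \<open>The derivative of an affine function along an edge is the difference of its values at
  the two end points, and barycentric coordinates have 0-1 values at the vertices.\<close>

lemma
  fixes v :: "nat \<Rightarrow> 'a::euclidean_space"
  assumes v: "simplex_vertices v n"
  shows dbary_in_one_forms:
      "(dbary v n i :: ('a, 'f::real_normed_field) form) \<in> one_forms (simplex_hull v n)"
    and dbary_edge: "\<And>x j k. x \<in> simplex_hull v n \<Longrightarrow> j \<le> n \<Longrightarrow> k \<le> n \<Longrightarrow>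
      dbary v n i x (v j - v k) = (of_bool (i = j) - of_bool (i = k) :: 'f)"
proof -
  let ?T = "simplex_hull v n" and ?f = "\<lambda>x. of_real (bary v n i x) :: 'f"
  have "affine_fun_on ?T (bary v n i)" unfolding bary_def by (rule affine_interp(1)[OF v])
  then have "affine_fun_on ?T ?f"
    unfolding affine_fun_on_def by (simp add: scaleR_conv_of_real)
  from frechet_derivative_affine_fun_on[OF v this]
  obtain L where L: "linear L" "\<And>x y. x \<in> ?T \<Longrightarrow> y \<in> ?T \<Longrightarrow> L (y - x) = ?f y - ?f x"
    "\<And>x u. x \<in> ?T \<Longrightarrow> u \<in> tangent ?T \<Longrightarrow> frechet_derivative ?f (at x within ?T) u = L u"
    by metis
  have d: "(dbary v n i :: ('a, 'f) form) = (\<lambda>x u. if x \<in> ?T \<and> u \<in> tangent ?T then L u else 0)"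
    by (auto simp: dbary_def ext_deriv_def L(3) fun_eq_iff)
  show "(dbary v n i :: ('a, 'f) form) \<in> one_forms ?T"
    by (auto simp: d one_forms_def tangent_def linear_add[OF L(1)] linear_scale[OF L(1)]
        intro: span_add span_scale)
  fix x j k assume "x \<in> ?T" "j \<le> n" "k \<le> n"
  then show "dbary v n i x (v j - v k) = (of_bool (i = j) - of_bool (i = k) :: 'f)"
    by (simp add: d L(2) diff_in_tangent vertex_in_simplex_hull bary_def affine_interp(2)[OF v])
qed

subsection \<open>Pullback along vertex permutations\<close>

lemma inv_permutes_le:
  assumes "\<pi> permutes {0..n::nat}" "j \<le> n" shows "inv \<pi> j \<le> n"
  using permutes_in_image[OF permutes_inv[OF assms(1)], of j] assms(2) by simp

lemma
  assumes v: "simplex_vertices v n"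
  shows simplex_map_affine: "affine_fun_on (simplex_hull v n) (simplex_map v n \<pi>)"
    and simplex_map_vertex: "j \<le> n \<Longrightarrow> simplex_map v n \<pi> (v j) = v (inv \<pi> j)"
  unfolding simplex_map_def by (rule affine_interp[OF v])+

lemma simplex_map_in_simplex_hull:
  assumes v: "simplex_vertices v n" and \<pi>: "\<pi> permutes {0..n}" and "x \<in> simplex_hull v n"
  shows "simplex_map v n \<pi> x \<in> simplex_hull v n"
proof -
  let ?T = "simplex_hull v n" and ?S = "simplex_map v n \<pi>"
  have "convex hull (v ` {0..n}) \<subseteq> {x \<in> ?T. ?S x \<in> ?T}"
  proof (rule hull_minimal)
    show "v ` {0..n} \<subseteq> {x \<in> ?T. ?S x \<in> ?T}"
      using simplex_map_vertex[OF v] inv_permutes_le[OF \<pi>] by (auto intro!: vertex_in_simplex_hull)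
    have "convex ?T" by (simp add: simplex_hull_def)
    then show "convex {x \<in> ?T. ?S x \<in> ?T}"
      using simplex_map_affine[OF v, of \<pi>] by (auto simp: convex_alt affine_fun_on_def)
  qed
  with assms(3) show ?thesis by (auto simp: simplex_hull_def)
qed

text \<open>The linear part of the simplex map sends differences of points of the simplex to such
  differences, so it preserves the tangent space; edges go to edges with relabelled end
  points.\<close>

lemma
  fixes v :: "nat \<Rightarrow> 'a::euclidean_space"
  assumes v: "simplex_vertices v n" and \<pi>: "\<pi> permutes {0..n}"
    and \<omega>: "(\<omega> :: ('a, 'f::real_normed_field) form) \<in> one_forms (simplex_hull v n)"
  shows pullback_in_one_forms:
      "pullback (simplex_hull v n) (simplex_map v n \<pi>) \<omega> \<in> one_forms (simplex_hull v n)"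
    and pullback_edge: "\<And>x j k. x \<in> simplex_hull v n \<Longrightarrow> j \<le> n \<Longrightarrow> k \<le> n \<Longrightarrow>
      pullback (simplex_hull v n) (simplex_map v n \<pi>) \<omega> x (v j - v k) =
      \<omega> (simplex_map v n \<pi> x) (v (inv \<pi> j) - v (inv \<pi> k))"
proof -
  let ?T = "simplex_hull v n" and ?S = "simplex_map v n \<pi>"
  note ST = simplex_map_in_simplex_hull[OF v \<pi>]
  obtain M where M: "linear M" "\<And>x y. x \<in> ?T \<Longrightarrow> y \<in> ?T \<Longrightarrow> M (y - x) = ?S y - ?S x"
    "\<And>x u. x \<in> ?T \<Longrightarrow> u \<in> tangent ?T \<Longrightarrow> frechet_derivative ?S (at x within ?T) u = M u"
    using frechet_derivative_affine_fun_on[OF v simplex_map_affine[OF v]] by metis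
  have "M ` tangent ?T \<subseteq> tangent ?T"
    unfolding tangent_def linear_span_image[OF M(1), symmetric]
    by (rule span_mono) (use M(2) ST in blast)
  then have MT: "M u \<in> tangent ?T" if "u \<in> tangent ?T" for u using that by blast
  have p: "pullback ?T ?S \<omega> = (\<lambda>x u. if x \<in> ?T \<and> u \<in> tangent ?T then \<omega> (?S x) (M u) else 0)"
    by (auto simp: pullback_def M(3) fun_eq_iff)
  have lin: "\<omega> (?S x) (a *\<^sub>R p + b *\<^sub>R q) = a *\<^sub>R \<omega> (?S x) p + b *\<^sub>R \<omega> (?S x) q"
    if "x \<in> ?T" "p \<in> tangent ?T" "q \<in> tangent ?T" for x a b p q
    using \<omega> that ST by (simp add: one_forms_def)
  show "pullback ?T ?S \<omega> \<in> one_forms ?T"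
    unfolding p one_forms_def
  proof (intro CollectI conjI ballI allI impI, goal_cases)
    case (1 x u w a b)
    moreover have "a *\<^sub>R u + b *\<^sub>R w \<in> tangent ?T"
      using 1 by (auto simp: tangent_def intro: span_add span_scale)
    ultimately show ?case
      by (simp add: linear_add[OF M(1)] linear_scale[OF M(1)] lin MT)
  qed auto
  fix x j k assume "x \<in> ?T" "j \<le> n" "k \<le> n"
  then show "pullback ?T ?S \<omega> x (v j - v k) = \<omega> (?S x) (v (inv \<pi> j) - v (inv \<pi> k))"
    by (simp add: p M(2) simplex_map_vertex[OF v] diff_in_tangent vertex_in_simplex_hull)
qed

text \<open>Both sides are compared on edges at \<open>v 0\<close>. The index moves by \<pi> itself
  although the vertices move by its inverse, since \<open>i = inv \<pi> j\<close> is the same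
  condition as \<open>\<pi> i = j\<close>.\<close>

lemma pullback_dbary:
  fixes v :: "nat \<Rightarrow> 'a::euclidean_space"
  assumes v: "simplex_vertices v n" and \<pi>: "\<pi> permutes {0..n}"
  shows "pullback (simplex_hull v n) (simplex_map v n \<pi>) (dbary v n i) =
    (dbary v n (\<pi> i) :: ('a, 'f::real_normed_field) form)"
proof (rule one_forms_eqI)
  note d = dbary_in_one_forms[OF v, where 'f = 'f]
  show "pullback (simplex_hull v n) (simplex_map v n \<pi>) (dbary v n i :: ('a, 'f) form)
      \<in> one_forms (simplex_hull v n)"
    by (rule pullback_in_one_forms[OF v \<pi> d])
  show "(dbary v n (\<pi> i) :: ('a, 'f) form) \<in> one_forms (simplex_hull v n)" by (rule d)
  fix x j assume x: "x \<in> simplex_hull v n" and j: "j \<le> n"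
  have eq: "i = inv \<pi> j \<longleftrightarrow> \<pi> i = j" for j
    using permutes_inverses[OF \<pi>] by metis
  show "pullback (simplex_hull v n) (simplex_map v n \<pi>) (dbary v n i) x (v j - v 0) =
      (dbary v n (\<pi> i) x (v j - v 0) :: 'f)"
    using x j inv_permutes_le[OF \<pi>]
    by (simp add: pullback_edge[OF v \<pi> d] dbary_edge[OF v] simplex_map_in_simplex_hull[OF v \<pi>] eq)
qed

lemma pullback_add:
  fixes \<omega> \<eta> :: "('a::real_normed_vector, 'f::real_normed_field) form"
  shows "pullback T S (\<omega> + \<eta>) = pullback T S \<omega> + pullback T S \<eta>"
  by (auto simp: pullback_def fun_eq_iff)

lemma pullback_scale: "pullback T S (form_scale c \<omega>) = form_scale c (pullback T S \<omega>)"
  by (auto simp: pullback_def form_scale_def fun_eq_iff)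

lemma pullback_zero: "pullback T S 0 = 0"
  by (auto simp: pullback_def fun_eq_iff)

lemma pullback_sum:
  fixes \<omega> :: "'i \<Rightarrow> ('a::real_normed_vector, 'f::real_normed_field) form"
  shows "pullback T S (\<Sum>i\<in>A. \<omega> i) = (\<Sum>i\<in>A. pullback T S (\<omega> i))"
proof (induction A rule: infinite_finite_induct)
  case (insert i A)
  then show ?case by (simp only: sum.insert[OF insert.hyps] pullback_add)
qed (simp_all only: sum.infinite sum.empty pullback_zero not_False_eq_True)

subsection \<open>The three sign vectors\<close>

text \<open>The rows are the coefficient vectors of \<open>psi_w\<close>, \<open>psi_p\<close> and
  \<open>psi_k\<close>, in this order. Integer entries allow one combinatorial argument to serve
  every scalar field through \<open>of_int\<close>.\<close>

definition sign_vec :: "nat \<Rightarrow> nat \<Rightarrow> int" where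
  "sign_vec i j = [[1, -1, 1, -1], [1, 1, -1, -1], [1, -1, -1, 1]] ! i ! j"

lemma sign_vec_simps:
  "sign_vec 0 0 = 1" "sign_vec 0 (Suc 0) = -1" "sign_vec 0 2 = 1" "sign_vec 0 3 = -1"
  "sign_vec (Suc 0) 0 = 1" "sign_vec (Suc 0) (Suc 0) = 1" "sign_vec (Suc 0) 2 = -1" "sign_vec (Suc 0) 3 = -1"
  "sign_vec 2 0 = 1" "sign_vec 2 (Suc 0) = -1" "sign_vec 2 2 = -1" "sign_vec 2 3 = 1"
  by (simp_all add: sign_vec_def)

lemma atMost_3: "{..3::nat} = {0, 1, 2, 3}"
  by auto

lemma lessThan_3: "{..<3::nat} = {0, 1, 2}"
  by auto

lemma sign_vec_values: "i < 3 \<Longrightarrow> j \<le> 3 \<Longrightarrow> sign_vec i j \<in> {1, -1}"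
  \<comment> \<open>Bounds on indices become membership in explicit finite sets, which splits the
    claim into numeric cases.\<close>
  unfolding lessThan_iff[symmetric] atMost_iff[symmetric] lessThan_3 atMost_3
  by (auto simp: sign_vec_simps)

lemma sum_sign_vec: "i < 3 \<Longrightarrow> (\<Sum>j\<le>3. sign_vec i j) = 0"
  unfolding lessThan_iff[symmetric] lessThan_3 atMost_3 by (auto simp: sign_vec_simps)

lemma sign_vec_orthogonal:
  "i < 3 \<Longrightarrow> k < 3 \<Longrightarrow> (\<Sum>j\<le>3. sign_vec i j * sign_vec k j) = (if i = k then 4 else 0)"
  unfolding lessThan_iff[symmetric] lessThan_3 atMost_3 by (auto simp: sign_vec_simps)

text \<open>Four signs with sum 0 contain two of each kind, so up to a global sign they amount to a
  splitting of the four indices into two pairs. There are three such splittings, one for each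
  row.\<close>

lemma balanced_sign_vector:
  fixes b :: "nat \<Rightarrow> int"
  assumes "\<And>j. j \<le> 3 \<Longrightarrow> b j \<in> {1, -1}" "(\<Sum>j\<le>3. b j) = 0"
  obtains k c where "k < 3" "c \<in> {1, -1}" "\<And>j. j \<le> 3 \<Longrightarrow> b j = c * sign_vec k j"
proof -
  have b: "b 0 \<in> {1, -1}" "b 1 \<in> {1, -1}" "b 2 \<in> {1, -1}" "b 3 \<in> {1, -1}"
    using assms(1) by simp_all
  have s: "b 0 + b 1 + b 2 + b 3 = 0" using assms(2) by (simp add: atMost_3)
  have "\<exists>k\<in>{0, 1, 2}. \<exists>c\<in>{1, -1}. \<forall>j\<in>{..3}. b j = c * sign_vec k j"
    using b s unfolding atMost_3 by (auto simp: sign_vec_simps)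
  then obtain k c where "k \<in> {0, 1, 2}" "c \<in> {1, -1}" "\<forall>j\<in>{..3}. b j = c * sign_vec k j"
    by blast
  then show thesis by (intro that[of k c]) auto
qed

text \<open>Permuting entries keeps them signs with sum 0, so each row again becomes a row up to
  sign. Permuting also preserves inner products: two rows sent to the same row would have inner
  product 4 or -4, against orthogonality.\<close>

lemma sign_vec_permuted:
  assumes \<pi>: "\<pi> permutes {..3}"
  obtains \<tau> c where "\<tau> permutes {..<3}" "\<And>i. i < 3 \<Longrightarrow> c i \<in> {1, -1::int}"
    "\<And>i j. i < 3 \<Longrightarrow> j \<le> 3 \<Longrightarrow> sign_vec i (inv \<pi> j) = c i * sign_vec (\<tau> i) j"
proof -
  note \<pi>' = permutes_inv[OF \<pi>]
  have "\<exists>k c. k < 3 \<and> c \<in> {1, -1} \<and> (\<forall>j\<le>3. sign_vec i (inv \<pi> j) = c * sign_vec k j)"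
    if i: "i < 3" for i
  proof -
    have "sign_vec i (inv \<pi> j) \<in> {1, -1}" if "j \<le> 3" for j
      using sign_vec_values[OF i] permutes_in_image[OF \<pi>', of j] that by simp
    moreover have "(\<Sum>j\<le>3. sign_vec i (inv \<pi> j)) = 0"
      using sum.permute[OF \<pi>', of "sign_vec i"] sum_sign_vec[OF i] by (simp add: o_def)
    ultimately show ?thesis using balanced_sign_vector[of "\<lambda>j. sign_vec i (inv \<pi> j)"] by metis
  qed
  then obtain t c where t: "\<And>i. i < 3 \<Longrightarrow> t i < 3" and c: "\<And>i. i < 3 \<Longrightarrow> c i \<in> {1, -1::int}"
    and eq: "\<And>i j. i < 3 \<Longrightarrow> j \<le> 3 \<Longrightarrow> sign_vec i (inv \<pi> j) = c i * sign_vec (t i) j"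
    by metis
  have "inj_on t {..<3}"
  proof (rule inj_onI)
    fix i k assume "i \<in> {..<3}" "k \<in> {..<3}" and tt: "t i = t k"
    then have ik: "i < 3" "k < 3" by auto
    have "(\<Sum>j\<le>3. sign_vec i j * sign_vec k j) = (\<Sum>j\<le>3. sign_vec i (inv \<pi> j) * sign_vec k (inv \<pi> j))"
      using sum.permute[OF \<pi>', of "\<lambda>j. sign_vec i j * sign_vec k j"] by (simp add: o_def)
    also have "\<dots> = (\<Sum>j\<le>3. (c i * c k) * (sign_vec (t i) j * sign_vec (t i) j))"
      using eq[OF ik(1)] eq[OF ik(2)] tt by (intro sum.cong) auto
    also have "\<dots> = 4 * (c i * c k)"
      by (simp add: sign_vec_orthogonal[OF t t] ik flip: sum_distrib_left)
    finally show "i = k"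
      using sign_vec_orthogonal[OF ik] c[OF ik(1)] c[OF ik(2)] by (auto split: if_splits)
  qed
  moreover have "t ` {..<3} \<subseteq> {..<3}" using t by auto
  ultimately have "bij_betw t {..<3} {..<3}"
    by (simp add: bij_betw_def endo_inj_surj)
  \<comment> \<open>The map \<open>t\<close> is unspecified from 3 on; \<open>permutes\<close>
    demands the identity there.\<close>
  then have "bij_betw (\<lambda>i. if i < 3 then t i else i) {..<3} {..<3}"
    by (rule bij_betw_cong[THEN iffD1, rotated]) simp
  then have "(\<lambda>i. if i < 3 then t i else i) permutes {..<3}"
    by (rule bij_imp_permutes) simp
  then show thesis
    using that[of "\<lambda>i. if i < 3 then t i else i" c] c eq by simp
qed

subsection \<open>The basis\<close>

text \<open>Indexing the three forms by rows lets a vertex permutation act through the index map of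
  \<open>sign_vec_permuted\<close>.\<close>

definition psi :: "(nat \<Rightarrow> 'a::real_normed_vector) \<Rightarrow> nat \<Rightarrow> ('a, 'f::real_normed_field) form" where
  "psi v i = (\<Sum>j\<le>3. form_scale (of_int (sign_vec i j)) (dbary v 3 j))"

lemma psi_eqs: "psi_w v = psi v 0" "psi_p v = psi v 1" "psi_k v = psi v 2"
  by (auto simp: psi_def psi_w_def psi_p_def psi_k_def atMost_3 sign_vec_simps form_scale_def fun_eq_iff)

lemma psi_edge:
  fixes v :: "nat \<Rightarrow> 'a::euclidean_space"
  assumes "simplex_vertices v 3" "x \<in> simplex_hull v 3" "j \<le> 3" "k \<le> 3"
  shows "psi v i x (v j - v k) = (of_int (sign_vec i j - sign_vec i k) :: 'f::real_normed_field)"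
  using assms(3,4)
  by (simp add: psi_def sum_form_apply form_scale_def dbary_edge[OF assms(1,2)] algebra_simps
      sum_subtractf of_bool_def if_distrib[of "\<lambda>x. _ * x"] cong: if_cong)

text \<open>Independence follows by evaluation on the three edges at \<open>v 0\<close>; spanning
  follows by solving explicitly for each \<open>dbary v 3 j\<close>.\<close>

lemma is_basis_psi:
  fixes v :: "nat \<Rightarrow> 'a::euclidean_space"
  assumes v: "simplex_vertices v 3"
  shows "is_basis [psi v 0, psi v 1, psi v 2] (const_one_forms v 3 :: ('a, 'f::real_normed_field) form set)"
proof -
  have x: "v 0 \<in> simplex_hull v 3" by (simp add: vertex_in_simplex_hull)
  let ?w = "psi v 0 :: ('a, 'f) form" and ?p = "psi v 1 :: ('a, 'f) form" and ?k = "psi v 2 :: ('a, 'f) form"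
  have zero: "a = 0 \<and> b = 0 \<and> c = 0"
    if *: "form_scale a ?w + form_scale b ?p + form_scale c ?k = 0" for a b c
  proof -
    \<comment> \<open>On the edge from \<open>v j\<close> to \<open>v 0\<close> each form takes the
      value 0 or 2, according to whether its signs at 0 and \<open>j\<close> agree. Each of the
      three edges thus relates two of the scalars.\<close>
    have e: "a * ?w (v 0) (v 0 - v j) + b * ?p (v 0) (v 0 - v j) + c * ?k (v 0) (v 0 - v j) = 0" for j
      using fun_cong[OF fun_cong[OF *, of "v 0"], of "v 0 - v j"] by (simp add: form_scale_def)
    have "2 * (a + c) = 0" "2 * (b + c) = 0" "2 * (a + b) = 0"
      using e[of 1] e[of 2] e[of 3]
      by (simp_all add: psi_edge[OF v x] sign_vec_simps algebra_simps)
    then have *: "a + c = 0" "b + c = 0" "a + b = 0" by (simp_all only: mult_eq_0_iff) simp_all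
    have "2 * a = (a + c) - (b + c) + (a + b)" by simp
    then have "a = 0" using * by simp
    then show ?thesis using * by simp
  qed
  have dist: "distinct [?w, ?p, ?k]"
    \<comment> \<open>Equality of two of the forms would be a vanishing combination with scalars 1
      and -1.\<close>
    using zero[of 1 "-1" 0] zero[of 1 0 "-1"] zero[of 0 1 "-1"]
    by (auto simp: form_scale_def fun_eq_iff)
  have "form_space.independent {?w, ?p, ?k}"
  proof
    assume "form_space.dependent {?w, ?p, ?k}"
    then obtain u where u: "\<exists>\<omega>\<in>{?w, ?p, ?k}. u \<omega> \<noteq> 0" "(\<Sum>\<omega>\<in>{?w, ?p, ?k}. form_scale (u \<omega>) \<omega>) = 0"
      using form_space.dependent_finite[of "{?w, ?p, ?k}"] by auto
    have "form_scale (u ?w) ?w + form_scale (u ?p) ?p + form_scale (u ?k) ?k = 0"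
      using u(2) dist by (simp add: add.assoc)
    from zero[OF this] u(1) show False by auto
  qed
  moreover have "form_space.span {?w, ?p, ?k} = const_one_forms v 3"
  proof
    have "psi v i \<in> form_space.span (dbary v 3 ` {0..3} :: ('a, 'f) form set)" for i
      unfolding psi_def by (intro form_space.span_sum form_space.span_scale form_space.span_base) auto
    then show "form_space.span {?w, ?p, ?k} \<subseteq> const_one_forms v 3"
      unfolding const_one_forms_def
      by (intro form_space.span_minimal form_space.subspace_span) auto
    \<comment> \<open>The rows together with a row of ones form a 4 by 4 Hadamard matrix, whose
      columns are orthogonal too. Hence \<open>?s j\<close> has coefficient 3 at \<open>j\<close>
      and -1 elsewhere, which is 4 times \<open>?d j\<close> minus the sum of all
      \<open>?d k\<close>; that sum vanishes on edges.\<close>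
    let ?s = "\<lambda>j. \<Sum>i\<in>{0,1,2}. form_scale (of_int (sign_vec i j)) (psi v i) :: ('a, 'f) form"
    let ?d = "\<lambda>j. dbary v 3 j :: ('a, 'f) form"
    have "?d j = form_scale (1/4) (?s j)" if "j \<le> 3" for j
    proof (rule one_forms_eqI)
      show "?d j \<in> one_forms (simplex_hull v 3)" by (rule dbary_in_one_forms[OF v])
      show "form_scale (1/4) (?s j) \<in> one_forms (simplex_hull v 3)"
        unfolding psi_def by (intro one_forms_scale one_forms_sum dbary_in_one_forms[OF v])
      fix x and k :: nat assume xk: "x \<in> simplex_hull v 3" "k \<le> 3"
      have "j \<in> {0,1,2,3}" "k \<in> {0,1,2,3}" using that xk(2) by auto
      then show "?d j x (v k - v 0) = form_scale (1/4) (?s j) x (v k - v 0)"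
        using xk by (auto simp: form_scale_def dbary_edge[OF v] psi_edge[OF v] sign_vec_simps)
    qed
    moreover have "form_scale (1/4) (?s j) \<in> form_space.span {?w, ?p, ?k}" for j
      by (intro form_space.span_scale form_space.span_sum form_space.span_base) auto
    ultimately show "const_one_forms v 3 \<subseteq> form_space.span {?w, ?p, ?k}"
      unfolding const_one_forms_def
      by (intro form_space.span_minimal form_space.subspace_span) auto
  qed
  ultimately show ?thesis using dist by (simp add: is_basis_def)
qed

text \<open>Pulling back permutes the \<open>dbary v 3 j\<close>, which after reindexing permutes
  the entries of the sign vector instead. The unit factors are the integer signs from
  \<open>sign_vec_permuted\<close>, embedded in the field.\<close>

lemma invariant_forms_psi:
  fixes v :: "nat \<Rightarrow> 'a::euclidean_space"
  assumes v: "simplex_vertices v 3"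
  shows "invariant_forms v 3 [psi v 0, psi v 1, psi v 2 :: ('a, 'f::real_normed_field) form]"
  unfolding invariant_forms_def
proof (intro conjI allI impI)
  let ?L = "[psi v 0, psi v 1, psi v 2 :: ('a, 'f) form]"
  have nth: "?L ! i = psi v i" if "i < 3" for i
    using that by (auto simp: less_Suc_eq numeral_3_eq_3 numeral_2_eq_2)
  show "distinct ?L"
    using is_basis_psi[OF v, where 'f = 'f] unfolding is_basis_def by blast
  have "psi v i \<in> (one_forms (simplex_hull v 3) :: ('a, 'f) form set)" for i
    unfolding psi_def by (intro one_forms_sum one_forms_scale dbary_in_one_forms[OF v])
  then show "set ?L \<subseteq> one_forms (simplex_hull v 3)" by simp
  fix \<pi> :: "nat \<Rightarrow> nat" assume \<pi>: "\<pi> permutes {0..3}"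
  then have \<pi>3: "\<pi> permutes {..3}" by (simp add: atLeast0AtMost)
  from sign_vec_permuted[OF \<pi>3] obtain \<tau> and c :: "nat \<Rightarrow> int" where \<tau>: "\<tau> permutes {..<3}"
    and c: "\<And>i. i < 3 \<Longrightarrow> c i \<in> {1, -1}"
    and eq: "\<And>i j. i < 3 \<Longrightarrow> j \<le> 3 \<Longrightarrow> sign_vec i (inv \<pi> j) = c i * sign_vec (\<tau> i) j"
    by metis
  have "pullback (simplex_hull v 3) (simplex_map v 3 \<pi>) (psi v i) =
      form_scale (of_int (c i)) (psi v (\<tau> i) :: ('a, 'f) form)" if i: "i < 3" for i
  proof -
    let ?g = "\<lambda>j. form_scale (of_int (sign_vec i (inv \<pi> j))) (dbary v 3 j) :: ('a, 'f) form"
    have "pullback (simplex_hull v 3) (simplex_map v 3 \<pi>) (psi v i) =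
        (\<Sum>j\<le>3. form_scale (of_int (sign_vec i j)) (dbary v 3 (\<pi> j)) :: ('a, 'f) form)"
      by (simp add: psi_def pullback_sum pullback_scale pullback_dbary[OF v \<pi>])
    \<comment> \<open>Reindexing along \<pi> moves the permutation from the forms to their
      coefficients, where it appears inverted.\<close>
    also have "\<dots> = (\<Sum>j\<le>3. ?g j)"
      using sum.permute[OF \<pi>3, of ?g] by (simp add: o_def permutes_inverses(2)[OF \<pi>])
    also have "\<dots> = (\<Sum>j\<le>3. form_scale (of_int (c i)) (form_scale (of_int (sign_vec (\<tau> i) j)) (dbary v 3 j)))"
      by (rule sum.cong) (simp_all add: eq[OF i])
    also have "\<dots> = form_scale (of_int (c i)) (psi v (\<tau> i))"
      by (simp add: psi_def form_space.scale_sum_right)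
    finally show ?thesis .
  qed
  moreover have "\<tau> i < 3" if "i < 3" for i
    using permutes_in_image[OF \<tau>, of i] that by simp
  moreover have "norm (of_int (c i) :: 'f) = 1" if "i < 3" for i
    using c[OF that] by auto
  moreover have "length ?L = 3" by simp
  ultimately show "\<exists>\<tau> c. \<tau> permutes {..<length ?L} \<and> (\<forall>i<length ?L. norm (c i) = 1 \<and>
      pullback (simplex_hull v 3) (simplex_map v 3 \<pi>) (?L ! i) = form_scale (c i) (?L ! \<tau> i))"
    using \<tau>
    by (intro exI[of _ \<tau>] exI[of _ "\<lambda>i. of_int (c i)"] conjI allI impI) (simp_all only: nth)
qed

text \<open>The real and complex claims are two instances of results that hold over any
  \<open>real_normed_field\<close>.\<close>

theorem lemma5p2:
  fixes v :: "nat \<Rightarrow> 'a::euclidean_space"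
  assumes "simplex_vertices v 3"
  shows "is_basis [psi_w v, psi_p v, psi_k v] (const_one_forms v 3 :: ('a, real) form set) \<and>
         invariant_forms v 3 [psi_w v, psi_p v, psi_k v :: ('a, real) form] \<and>
         is_basis [psi_w v, psi_p v, psi_k v] (const_one_forms v 3 :: ('a, complex) form set) \<and>
         invariant_forms v 3 [psi_w v, psi_p v, psi_k v :: ('a, complex) form]"
  unfolding psi_eqs by (intro conjI is_basis_psi invariant_forms_psi assms)

end
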